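(* Suppose equilibria exist in the scenarios (SWH) and (CS). Then: (i) the equilibrium utility for workers in the scenario (CS) is higher than that in the scenario (SWH), i.e. $\rho^{\mathrm{CS}}>\rho^{\mathrm{SWH}}$; (ii) the total commuting cost in the scenario (CS) is lower than that in the scenario (SWH), i.e. $TC^{\mathrm{CS}}<TC^{\mathrm{SWH}}$.
   Context: Setting. There are locations $1,\dots,I$, indexed by increasing distance from a central business district (CBD). Location $i$ has land area $A_i>0$; each worker consumes one unit of land and there are $\sum_i A_i$ workers in total, so exactly $A_i$ workers live at $i$. Bottleneck capacities satisfy $\mu_1>\dots>\mu_I>0$; put $\mu_{I+1}=0$ and $\bar\mu_i=\mu_i-\mu_{i+1}$. Free-flow travel times are $f_i\ge 0$. Daily wages for office and remote work are $\theta^O>\theta^R$. The schedule delay cost for preferred arrival time $t_k$ is $\beta(t_k-t)$ if $t<t_k$ and $\gamma(t-t_k)$ if $t\ge t_k$, with $0<\beta<1$, $\gamma>0$ and $\gamma<\bar\mu_i/\mu_{i+1}$ for $i<I$; put $\delta=\beta\gamma/(\beta+\gamma)$. Let $K\in\{1,2\}$ be the number of preferred arrival times; for $K=2$ let $d=t_2-t_1>0$. If $X>0$ commuters use capacity $\mu$, the resulting short-term equilibrium commuting cost per trip (excluding free-flow time) is $\bar c_K(X,\mu)=\frac{X}{\mu}\delta-d(K-1)\delta$. Equilibrium. Given a set $\mathcal H\subseteq[0,1]$ of office work ratios and $K$, an equilibrium consists of an index $i^*\in\{1,\dots,I\}$, office work ratios $\eta(i)\in\mathcal H$ (all workers at $i$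 choose $\eta(i)$), land rents $r_i\ge0$ with $r_I=0$, costs $\kappa_i$, and a utility $\rho\in\mathbb R$ such that, with $X_i=\eta(i)A_i$: (a) $\eta(i)>0$ if and only if $i\le i^*$; (b) $\kappa_i=\bar c_K(X_i,\bar\mu_i)$ for $i\le i^*$, $\kappa_1<\dots<\kappa_{i^*}$, and $\kappa_i\ge\kappa_{i^*}$ for $i>i^*$; (c) if $K=2$, then $\kappa_i\ge d\delta$ for $i\le i^*$ (equivalently, the arrival time windows are intervals); (d) for all $i$ and all $h\in\mathcal H$, $h\big(\theta^O-\kappa_i-\sum_{j\le i}f_j\big)+(1-h)\theta^R-r_i\le\rho$, with equality for $h=\eta(i)$; (e) if $\mathcal H=[0,1]$, then $0<\eta(i^* )<1$ (location $i^*$ is the mixed zone). The equilibrium commuting cost $\lambda_i(\eta(i))$ is $\kappa_i$ for $i\le i^*$ and $0$ for $i>i^*$ (nobody commutes there). The total commuting cost is $TC=\sum_i\lambda_i(\eta(i))\,\eta(i)A_i$. Scenarios (all other parameters being the same), indicated by superscripts: (SWH) staggered work hours: $\mathcal H=\{1\}$, $K=2$; (CS) combined scheme: $\mathcal H=[0,1]$, $K=2$. *)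

theory Defs
  imports Complex_Main
begin

text \<open>
  Locations are the naturals \<open>1, ..., locs c\<close>; the values of \<open>area\<close>, \<open>capac\<close> and \<open>freeflow\<close>
  at other arguments are irrelevant. In particular the convention that the capacity beyond the last
  location is \<open>0\<close> is built into \<open>residual_capac\<close>, not into \<open>capac\<close>.
\<close>

record city =
  locs :: nat
  area :: "nat \<Rightarrow> real"
  capac :: "nat \<Rightarrow> real"
  freeflow :: "nat \<Rightarrow> real"
  wage_office :: real
  wage_remote :: real
  early_rate :: real  \<comment> \<open>the slope \<open>\<beta>\<close> of the schedule delay cost before the preferred time\<close>
  late_rate :: real   \<comment> \<open>the slope \<open>\<gamma>\<close> of the schedule delay cost after the preferred time\<close>
  pref_time1 :: real
  pref_time2 :: real  \<comment> \<open>only used when there are two preferred arrival times\<close>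

definition residual_capac :: "city \<Rightarrow> nat \<Rightarrow> real" where
  "residual_capac c i = capac c i - (if i < locs c then capac c (Suc i) else 0)"

definition delta :: "city \<Rightarrow> real" where
  "delta c = early_rate c * late_rate c / (early_rate c + late_rate c)"

definition time_gap :: "city \<Rightarrow> real" where
  "time_gap c = pref_time2 c - pref_time1 c"

definition valid_city :: "city \<Rightarrow> bool" where
  "valid_city c \<longleftrightarrow>
     1 \<le> locs c \<and>
     (\<forall>i\<in>{1..locs c}. 0 < area c i) \<and>
     (\<forall>i\<in>{1..<locs c}. capac c (Suc i) < capac c i) \<and>
     0 < capac c (locs c) \<and>
     (\<forall>i\<in>{1..locs c}. 0 \<le> freeflow c i) \<and>
     wage_remote c < wage_office c \<and>
     0 < early_rate c \<and> early_rate c < 1 \<and>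
     0 < late_rate c \<and>
     (\<forall>i\<in>{1..<locs c}. late_rate c < residual_capac c i / capac c (Suc i)) \<and>
     0 < time_gap c"

text \<open>
  The short-term equilibrium cost per trip, net of free-flow time, when \<open>X > 0\<close> commuters with \<open>K\<close>
  preferred arrival times use a bottleneck capacity \<open>m\<close>, in closed form.
\<close>

definition bottleneck_cost :: "city \<Rightarrow> nat \<Rightarrow> real \<Rightarrow> real \<Rightarrow> real" where
  "bottleneck_cost c K X m = X / m * delta c - time_gap c * (real K - 1) * delta c"

record allocation =
  istar :: nat
  office_ratio :: "nat \<Rightarrow> real"
  land_rent :: "nat \<Rightarrow> real"
  kappa :: "nat \<Rightarrow> real"
  utility :: real

text \<open>
  The net income at location \<open>i\<close> of a worker who works in the office for the share \<open>h\<close> of days.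
  All workers at a location choose the same ratio, so \<open>office_ratio e i * area c i\<close>
  is the number of commuters from \<open>i\<close>.
\<close>

definition payoff :: "city \<Rightarrow> allocation \<Rightarrow> nat \<Rightarrow> real \<Rightarrow> real" where
  "payoff c e i h =
     h * (wage_office c - kappa e i - (\<Sum>j=1..i. freeflow c j))
     + (1 - h) * wage_remote c - land_rent e i"

definition equilibrium :: "city \<Rightarrow> real set \<Rightarrow> nat \<Rightarrow> allocation \<Rightarrow> bool" where
  "equilibrium c H K e \<longleftrightarrow>
     istar e \<in> {1..locs c} \<and>
     (\<forall>i\<in>{1..locs c}. office_ratio e i \<in> H) \<and>
     (\<forall>i\<in>{1..locs c}. 0 \<le> land_rent e i) \<and> land_rent e (locs c) = 0 \<and>
     (\<forall>i\<in>{1..locs c}. 0 < office_ratio e i \<longleftrightarrow> i \<le> istar e) \<and>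
     (\<forall>i\<in>{1..istar e}.
        kappa e i = bottleneck_cost c K (office_ratio e i * area c i) (residual_capac c i)) \<and>
     strict_mono_on {1..istar e} (kappa e) \<and>
     (\<forall>i\<in>{istar e<..locs c}. kappa e (istar e) \<le> kappa e i) \<and>
     (K = 2 \<longrightarrow> (\<forall>i\<in>{1..istar e}. time_gap c * delta c \<le> kappa e i)) \<and>
     (\<forall>i\<in>{1..locs c}.
        (\<forall>h\<in>H. payoff c e i h \<le> utility e) \<and> payoff c e i (office_ratio e i) = utility e) \<and>
     (H = {0..1} \<longrightarrow> 0 < office_ratio e (istar e) \<and> office_ratio e (istar e) < 1)"

definition commuting_cost :: "allocation \<Rightarrow> nat \<Rightarrow> real" where
  "commuting_cost e i = (if i \<le> istar e then kappa e i else 0)"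

definition total_commuting_cost :: "city \<Rightarrow> allocation \<Rightarrow> real" where
  "total_commuting_cost c e =
     (\<Sum>i=1..locs c. commuting_cost e i * office_ratio e i * area c i)"

text \<open>Staggered work hours, and their combination with a free choice of the office ratio.\<close>

definition equilibrium_SWH :: "city \<Rightarrow> allocation \<Rightarrow> bool" where
  "equilibrium_SWH c e \<longleftrightarrow> equilibrium c {1} 2 e"

definition equilibrium_CS :: "city \<Rightarrow> allocation \<Rightarrow> bool" where
  "equilibrium_CS c e \<longleftrightarrow> equilibrium c {0..1} 2 e"

end

theory Submission
  imports Defs
begin

text \<open>
  In (CS) a worker in the mixed zone is indifferent between all office ratios, and together with
  the zero rent at the outermost location this forces \<open>\<rho> = \<theta>\<^sup>R\<close>. In (SWH) everybody commutes, so
  \<open>\<rho>\<close> is the office income at the outermost location. Since fewer people commute from the mixed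
  zone in (CS), its commuting cost is below the one in (SWH), which in turn is at most that of the
  outermost location; as free-flow times accumulate outwards, the remote wage exceeds the (SWH)
  utility. The comparison of total costs holds location by location, strictly in the mixed zone.
\<close>

lemma delta_pos: "valid_city c \<Longrightarrow> 0 < delta c"
  by (simp add: valid_city_def delta_def)

text \<open>Capacities strictly decrease outwards, and at the last location the residual capacity is
  the positive capacity itself.\<close>

lemma residual_capac_pos:
  assumes "valid_city c" "i \<in> {1..locs c}"
  shows "0 < residual_capac c i"
  using assms by (cases "i = locs c") (auto simp: valid_city_def residual_capac_def)

lemma bottleneck_cost_mono:
  assumes "valid_city c" "0 < m" "X \<le> Y"
  shows "bottleneck_cost c K X m \<le> bottleneck_cost c K Y m"
  using assms delta_pos[of c]
  by (simp add: bottleneck_cost_def divide_right_mono mult_right_mono)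

lemma bottleneck_cost_strict_mono:
  assumes "valid_city c" "0 < m" "X < Y"
  shows "bottleneck_cost c K X m < bottleneck_cost c K Y m"
  using assms delta_pos[of c]
  by (simp add: bottleneck_cost_def divide_strict_right_mono)

lemma SWH_office_ratio:
  assumes "equilibrium_SWH c e" "i \<in> {1..locs c}"
  shows "office_ratio e i = 1"
  using assms by (auto simp: equilibrium_SWH_def equilibrium_def)

text \<open>The only admissible ratio is 1, which is positive even at the outermost location, so
  \<open>istar e\<close> cannot stop short of it.\<close>

lemma SWH_istar:
  assumes "equilibrium_SWH c e"
  shows "istar e = locs c"
proof -
  have "istar e \<in> {1..locs c}"
    and pos: "\<forall>i\<in>{1..locs c}. 0 < office_ratio e i \<longleftrightarrow> i \<le> istar e"
    using assms by (auto simp: equilibrium_SWH_def equilibrium_def)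
  moreover from this have "locs c \<in> {1..locs c}" by simp
  ultimately show ?thesis
    using SWH_office_ratio[OF assms, of "locs c"] by fastforce
qed

lemma SWH_utility:
  assumes "equilibrium_SWH c e"
  shows "utility e = wage_office c - kappa e (locs c) - (\<Sum>j=1..locs c. freeflow c j)"
proof -
  have N: "locs c \<in> {1..locs c}"
    using assms by (auto simp: equilibrium_SWH_def equilibrium_def)
  then have "payoff c e (locs c) (office_ratio e (locs c)) = utility e"
    and "land_rent e (locs c) = 0"
    using assms unfolding equilibrium_SWH_def equilibrium_def by blast+
  then show ?thesis
    using SWH_office_ratio[OF assms N] by (simp add: payoff_def)
qed

text \<open>The payoff is affine in the office ratio with slope \<open>s\<close>; a maximum over
  \<open>{0..1}\<close> attained at an interior point forces \<open>s = 0\<close>.\<close>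

lemma CS_mixed_zone_indifference:
  assumes "equilibrium_CS c e"
  shows "wage_office c - kappa e (istar e) - (\<Sum>j=1..istar e. freeflow c j) = wage_remote c"
proof -
  define h where "h = office_ratio e (istar e)"
  define s where
    "s = wage_office c - kappa e (istar e) - (\<Sum>j=1..istar e. freeflow c j) - wage_remote c"
  have payoff: "payoff c e (istar e) x = x * s + wage_remote c - land_rent e (istar e)" for x
    by (simp add: payoff_def s_def algebra_simps)
  have opt: "payoff c e (istar e) x \<le> payoff c e (istar e) h" if "x \<in> {0..1}" for x
    using assms that by (auto simp: equilibrium_CS_def equilibrium_def h_def)
  have h: "0 < h" "h < 1"
    using assms by (auto simp: equilibrium_CS_def equilibrium_def h_def)
  \<comment> \<open>Deviating to fully remote work bounds \<open>s\<close> from below, deviating to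
    full office work bounds it from above.\<close>
  have "0 \<le> h * s"
    using opt[of 0] by (simp add: payoff)
  moreover have "(1 - h) * s \<le> 0"
    using opt[of 1] by (simp add: payoff algebra_simps)
  ultimately have "s = 0"
    using h by (simp add: zero_le_mult_iff mult_le_0_iff)
  then show ?thesis by (simp add: s_def)
qed

text \<open>The outermost location bears no rent and is either the mixed zone, where office and
  remote work pay the same, or fully remote.\<close>

lemma CS_utility:
  assumes "equilibrium_CS c e"
  shows "utility e = wage_remote c"
proof -
  have istar: "istar e \<in> {1..locs c}"
    and N: "locs c \<in> {1..locs c}"
    and rent: "land_rent e (locs c) = 0"
    and ratio: "office_ratio e (locs c) \<in> {0..1}"
      "0 < office_ratio e (locs c) \<longleftrightarrow> locs c \<le> istar e"
    using assms by (auto simp: equilibrium_CS_def equilibrium_def)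
  have util: "payoff c e (locs c) (office_ratio e (locs c)) = utility e"
    using assms N unfolding equilibrium_CS_def equilibrium_def by blast
  show ?thesis
  proof (cases "istar e = locs c")
    case True
    then show ?thesis
      using CS_mixed_zone_indifference[OF assms] util rent
      by (simp add: payoff_def algebra_simps)
  next
    case False
    then have "office_ratio e (locs c) = 0"
      using istar ratio by auto
    then show ?thesis
      using util rent by (simp add: payoff_def)
  qed
qed

theorem theorem3:
  fixes c :: city and swh cs :: allocation
  assumes "valid_city c"
    and "equilibrium_SWH c swh"
    and "equilibrium_CS c cs"
  shows "utility cs > utility swh \<and>
    total_commuting_cost c cs < total_commuting_cost c swh"
proof -
  define N where "N = locs c"
  define m where "m = istar cs"
  have area: "0 < area c i" if "i \<in> {1..N}" for i
    using assms(1) that by (auto simp: valid_city_def N_def)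
  have m: "m \<in> {1..N}" "office_ratio cs m < 1"
    and ratio: "\<And>i. i \<in> {1..N} \<Longrightarrow> office_ratio cs i \<in> {0..1}"
    and cs: "\<And>i. i \<in> {1..m} \<Longrightarrow> kappa cs i =
      bottleneck_cost c 2 (office_ratio cs i * area c i) (residual_capac c i)"
    and cs_ge: "\<And>i. i \<in> {1..m} \<Longrightarrow> time_gap c * delta c \<le> kappa cs i"
    using assms(3) by (auto simp: equilibrium_CS_def equilibrium_def N_def m_def)
  have swh_istar: "istar swh = N"
    using SWH_istar[OF assms(2)] by (simp add: N_def)
  have swh: "kappa swh i = bottleneck_cost c 2 (area c i) (residual_capac c i)"
    if "i \<in> {1..N}" for i
  proof -
    have "i \<in> {1..istar swh}" using that swh_istar by simp
    then have "kappa swh i =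
      bottleneck_cost c 2 (office_ratio swh i * area c i) (residual_capac c i)"
      using assms(2) by (auto simp: equilibrium_SWH_def equilibrium_def)
    then show ?thesis
      using SWH_office_ratio[OF assms(2), of i] that by (simp add: N_def)
  qed
  \<comment> \<open>The interval condition on arrival windows makes this a lower bound for every
    equilibrium cost, so all costs on commuting locations are positive.\<close>
  have gap: "0 < time_gap c * delta c"
    using assms(1) delta_pos by (simp add: valid_city_def)
  have swh_pos: "0 < kappa swh i" if "i \<in> {1..N}" for i
  proof -
    have "time_gap c * delta c \<le> kappa swh i"
      using assms(2) that swh_istar by (auto simp: equilibrium_SWH_def equilibrium_def)
    then show ?thesis using gap by simp
  qed
  \<comment> \<open>At most as many commuters share the same residual capacity.\<close>
  have kappa_le: "kappa cs i \<le> kappa swh i" if "i \<in> {1..m}" for i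
  proof -
    have i: "i \<in> {1..N}" using that m by auto
    have "office_ratio cs i * area c i \<le> area c i"
      using ratio[OF i] area[OF i] by (simp add: mult_left_le_one_le)
    then show ?thesis
      using cs[OF that] swh[OF i] bottleneck_cost_mono[OF assms(1) residual_capac_pos] assms(1) i
      by (simp add: N_def)
  qed
  have kappa_less: "kappa cs m < kappa swh m"
  proof -
    have "office_ratio cs m * area c m < area c m"
      using m area by simp
    then show ?thesis
      using cs[of m] swh[of m] bottleneck_cost_strict_mono[OF assms(1) residual_capac_pos]
        assms(1) m
      by (simp add: N_def)
  qed

  have "kappa swh m \<le> kappa swh N"
  proof (cases "m = N")
    case False
    then have "m < N" using m by simp
    moreover have "strict_mono_on {1..N} (kappa swh)"
      using assms(2) swh_istar by (auto simp: equilibrium_SWH_def equilibrium_def)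
    ultimately have "kappa swh m < kappa swh N"
      using m by (auto elim!: strict_mono_onD)
    then show ?thesis by simp
  qed simp
  moreover have "(\<Sum>j=1..m. freeflow c j) \<le> (\<Sum>j=1..N. freeflow c j)"
    using m(1) assms(1) by (intro sum_mono2) (auto simp: valid_city_def N_def)
  ultimately have "utility swh < utility cs"
    using kappa_less CS_mixed_zone_indifference[OF assms(3)] CS_utility[OF assms(3)]
      SWH_utility[OF assms(2)]
    by (simp add: N_def m_def)

  moreover have "total_commuting_cost c cs < total_commuting_cost c swh"
    unfolding total_commuting_cost_def N_def[symmetric]
  \<comment> \<open>Weak inequality of all summands, with the mixed zone \<open>m\<close> as witness
    for a strict one.\<close>
  proof (rule sum_strict_mono_ex1)
    have "commuting_cost cs i * office_ratio cs i \<le> commuting_cost swh i * office_ratio swh i"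
      if i: "i \<in> {1..N}" for i
    proof (cases "i \<le> m")
      case True
      then have "kappa cs i * office_ratio cs i \<le> kappa swh i * 1"
        using i ratio[OF i] kappa_le[of i] swh_pos[OF i] by (intro mult_mono) auto
      then show ?thesis
        using i True SWH_office_ratio[OF assms(2)] swh_istar
        by (simp add: commuting_cost_def m_def N_def)
    next
      \<comment> \<open>Beyond \<open>m\<close> the cost is 0 in (CS) by convention, while it is
        positive in (SWH).\<close>
      case False
      then show ?thesis
        using i swh_pos[OF i] SWH_office_ratio[OF assms(2)] swh_istar
        by (simp add: commuting_cost_def m_def N_def)
    qed
    then show "\<forall>i\<in>{1..N}. commuting_cost cs i * office_ratio cs i * area c i
        \<le> commuting_cost swh i * office_ratio swh i * area c i"
      using area by (auto intro!: mult_right_mono less_imp_le)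
    \<comment> \<open>Positivity ensures that scaling the cost by a ratio below 1 does not raise
      it.\<close>
    have "0 < kappa cs m"
      using cs_ge[of m] gap m by simp
    then have "kappa cs m * office_ratio cs m < kappa swh m"
      using kappa_less m by (smt (verit) mult_less_cancel_left2)
    then have "commuting_cost cs m * office_ratio cs m * area c m
        < commuting_cost swh m * office_ratio swh m * area c m"
      using area[OF m(1)] m SWH_office_ratio[OF assms(2), of m] swh_istar
      by (simp add: commuting_cost_def m_def N_def)
    then show "\<exists>i\<in>{1..N}. commuting_cost cs i * office_ratio cs i * area c i
        < commuting_cost swh i * office_ratio swh i * area c i"
      using m(1) by blast
  qed simp
  ultimately show ?thesis by simp
qed

end
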